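(* Let $U$ and $V$ be totally ordered supertropical semirings and let $\alpha:U\to V$ be an order preserving map ($x\le y\Rightarrow\alpha(x)\le\alpha(y)$) which is multiplicative, i.e., $\alpha(xy)=\alpha(x)\alpha(y)$ for any $x,y\in U$. The following are equivalent: (1) $\alpha(0)=0$, $\alpha(1)=1$, $\alpha(e)=e$. (2) $\alpha$ is a semiring homomorphism. (3) $\alpha$ is a (monotone) transmission. Here $e$ denotes the element $1+1$ in $U$ and in $V$.
   Context: All semirings are commutative with $0$ and $1$. A bipotent semiring is a semiring $M$ equipped with a total ordering such that $(M,\cdot)$ is a totally ordered monoid with smallest element $0$ (absorbing), and $x+y=\max(x,y)$. A supertropical semiring is a semiring $U$ such that $e:=1+1$ is idempotent, $eU$ is (with its operations) a bipotent semiring, and for all $x,y\in U$: $x+y=y$ if $ex<ey$, $x+y=x$ if $ex>ey$, $x+y=ex$ if $ex=ey$. A totally ordered supertropical semiring is a supertropical semiring $U$ with a total ordering $\le$ of the set $U$ such that $x\le y$ implies $x+z\le y+z$ and $xz\le yz$ for all $x,y,z\in U$, and $0\le1$. (Such an ordering restricts on $eU$ to the ordering of the bipotent semiring $eU$.) A transmission $\alpha:U\to V$ between supertropical semirings is a multiplicative map with $\alpha(0)=0$, $\alpha(1)=1$, $\alpha(e)=e$ which restricts to a semiring homomorphism from $eU$ to $eV$. A transmission between totally ordered supertropical semirings is monotone if it is order preserving. *)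

theory Defs
  imports "HOL-Algebra.Ring"
begin

locale commutative_semiring = semiring R + comm_monoid R for R (structure)

definition total_order_on :: "'a set \<Rightarrow> ('a \<Rightarrow> 'a \<Rightarrow> bool) \<Rightarrow> bool" where
  "total_order_on A leq \<longleftrightarrow> reflp_on A leq \<and> transp_on A leq \<and> antisymp_on A leq \<and> totalp_on A leq"

locale bipotent_semiring = commutative_semiring M for M (structure) +
  fixes leq :: "'a \<Rightarrow> 'a \<Rightarrow> bool"
  assumes total_order: "total_order_on (carrier M) leq"
    and mult_mono: "\<lbrakk>x \<in> carrier M; y \<in> carrier M; z \<in> carrier M; leq x y\<rbrakk> \<Longrightarrow> leq (x \<otimes> z) (y \<otimes> z)"
    and zero_least: "x \<in> carrier M \<Longrightarrow> leq \<zero> x"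
    and add_max: "\<lbrakk>x \<in> carrier M; y \<in> carrier M\<rbrakk> \<Longrightarrow> x \<oplus> y = (if leq x y then y else x)"

definition e_of :: "('a, 'm) ring_scheme \<Rightarrow> 'a" where
  "e_of U = \<one>\<^bsub>U\<^esub> \<oplus>\<^bsub>U\<^esub> \<one>\<^bsub>U\<^esub>"

text \<open>The subset \<open>eU\<close> with the operations of \<open>U\<close>; its unit element is \<open>e\<close>, not the unit of \<open>U\<close>.\<close>

definition ghost :: "('a, 'm) ring_scheme \<Rightarrow> ('a, 'm) ring_scheme" where
  "ghost U = U\<lparr>carrier := (\<lambda>x. e_of U \<otimes>\<^bsub>U\<^esub> x) ` carrier U, one := e_of U\<rparr>"

text \<open>
  The relation \<open>leq\<close> below is the total ordering of the bipotent semiring \<open>eU\<close>. It is determined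
  on \<open>eU\<close> by the addition (\<open>x \<le> y\<close> iff \<open>x + y = y\<close>), so it is existentially quantified rather
  than made a parameter.
\<close>

locale supertropical_semiring = commutative_semiring U for U (structure) +
  assumes e_idem: "e_of U \<otimes> e_of U = e_of U"
    and ghost_bipotent: "\<exists>leq. bipotent_semiring (ghost U) leq \<and>
      (\<forall>x \<in> carrier U. \<forall>y \<in> carrier U.
        let ex = e_of U \<otimes> x; ey = e_of U \<otimes> y in
          (leq ex ey \<and> ex \<noteq> ey \<longrightarrow> x \<oplus> y = y) \<and>
          (leq ey ex \<and> ex \<noteq> ey \<longrightarrow> x \<oplus> y = x) \<and>
          (ex = ey \<longrightarrow> x \<oplus> y = ex))"

locale ordered_supertropical_semiring = supertropical_semiring U for U (structure) +
  fixes leq :: "'a \<Rightarrow> 'a \<Rightarrow> bool"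
  assumes total_order: "total_order_on (carrier U) leq"
    and add_mono: "\<lbrakk>x \<in> carrier U; y \<in> carrier U; z \<in> carrier U; leq x y\<rbrakk> \<Longrightarrow> leq (x \<oplus> z) (y \<oplus> z)"
    and mult_mono: "\<lbrakk>x \<in> carrier U; y \<in> carrier U; z \<in> carrier U; leq x y\<rbrakk> \<Longrightarrow> leq (x \<otimes> z) (y \<otimes> z)"
    and zero_le_one: "leq \<zero> \<one>"

text \<open>\<open>ring_hom\<close> does not mention zero, whose preservation is not automatic for semirings.\<close>

definition semiring_hom :: "('a, 'm) ring_scheme \<Rightarrow> ('b, 'n) ring_scheme \<Rightarrow> ('a \<Rightarrow> 'b) set" where
  "semiring_hom R S = {h \<in> ring_hom R S. h \<zero>\<^bsub>R\<^esub> = \<zero>\<^bsub>S\<^esub>}"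

definition transmission :: "('a, 'm) ring_scheme \<Rightarrow> ('b, 'n) ring_scheme \<Rightarrow> ('a \<Rightarrow> 'b) set" where
  "transmission U V = {\<alpha> \<in> hom U V.
     \<alpha> \<zero>\<^bsub>U\<^esub> = \<zero>\<^bsub>V\<^esub> \<and> \<alpha> \<one>\<^bsub>U\<^esub> = \<one>\<^bsub>V\<^esub> \<and> \<alpha> (e_of U) = e_of V \<and>
     \<alpha> \<in> semiring_hom (ghost U) (ghost V)}"

definition monotone_transmission ::
  "('a, 'm) ring_scheme \<Rightarrow> ('a \<Rightarrow> 'a \<Rightarrow> bool) \<Rightarrow> ('b, 'n) ring_scheme \<Rightarrow> ('b \<Rightarrow> 'b \<Rightarrow> bool)
    \<Rightarrow> ('a \<Rightarrow> 'b) set" where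
  "monotone_transmission U leU V leV =
     {\<alpha> \<in> transmission U V. monotone_on (carrier U) leU leV \<alpha>}"

end

theory Submission
  imports Defs
begin

text \<open>
  Only the additivity of \<open>\<alpha>\<close> under (1) needs an argument. Since \<open>0 \<le> 1\<close>, a sum dominates
  its summands, so the ordering of \<open>U\<close> induces the one of \<open>eU\<close>. If \<open>ex < ey\<close>, then
  \<open>ex \<le> y \<le> ey\<close>. Either \<open>\<alpha>(ex) < \<alpha>(ey)\<close>, or \<open>\<alpha>\<close> collapses this interval to a
  point, so \<open>\<alpha>(y) = e\<alpha>(y)\<close> is ghost; in both cases \<open>\<alpha>(x) + \<alpha>(y) = \<alpha>(y)\<close>.
\<close>

context supertropical_semiring
begin

lemma e_closed [simp]: "e_of U \<in> carrier U"
  by (simp add: e_of_def)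

lemma add_self: "x \<in> carrier U \<Longrightarrow> x \<oplus> x = e_of U \<otimes> x"
  by (simp add: e_of_def l_distr)

lemma e_absorb: "x \<in> carrier U \<Longrightarrow> e_of U \<otimes> (e_of U \<otimes> x) = e_of U \<otimes> x"
  by (simp add: e_idem flip: m_assoc)

text \<open>This eliminates the existentially quantified ordering of \<open>eU\<close>: each case is
  described by sums alone. The last equation in \<open>less\<close> and \<open>greater\<close> keeps
  the information that one ghost lies below the other, in a form that the ordering of U can
  exploit.\<close>

lemma add_cases:
  assumes x: "x \<in> carrier U" and y: "y \<in> carrier U"
  obtains (eq) "e_of U \<otimes> x = e_of U \<otimes> y" "x \<oplus> y = e_of U \<otimes> x"
  | (less) "e_of U \<otimes> x \<noteq> e_of U \<otimes> y" "x \<oplus> y = y" "e_of U \<otimes> x \<oplus> y = y"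
  | (greater) "e_of U \<otimes> x \<noteq> e_of U \<otimes> y" "x \<oplus> y = x" "e_of U \<otimes> y \<oplus> x = x"
proof -
  obtain le where bip: "bipotent_semiring (ghost U) le"
    and add: "\<And>x y. x \<in> carrier U \<Longrightarrow> y \<in> carrier U \<Longrightarrow>
      (le (e_of U \<otimes> x) (e_of U \<otimes> y) \<and> e_of U \<otimes> x \<noteq> e_of U \<otimes> y \<longrightarrow> x \<oplus> y = y) \<and>
      (le (e_of U \<otimes> y) (e_of U \<otimes> x) \<and> e_of U \<otimes> x \<noteq> e_of U \<otimes> y \<longrightarrow> x \<oplus> y = x) \<and>
      (e_of U \<otimes> x = e_of U \<otimes> y \<longrightarrow> x \<oplus> y = e_of U \<otimes> x)"
    using ghost_bipotent unfolding Let_def by blast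
  have "totalp_on ((\<lambda>x. e_of U \<otimes> x) ` carrier U) le"
    using bipotent_semiring.total_order[OF bip] by (simp add: Defs.total_order_on_def ghost_def)
  then have total: "le (e_of U \<otimes> x) (e_of U \<otimes> y) \<or> le (e_of U \<otimes> y) (e_of U \<otimes> x)"
    if "e_of U \<otimes> x \<noteq> e_of U \<otimes> y"
    using that x y by (auto dest: totalp_onD)
  show thesis
    \<comment> \<open>As e is idempotent, replacing the smaller summand by its ghost leaves the
      comparison of ghosts unchanged. The addition rule at \<open>ex, y\<close> and
      \<open>ey, x\<close> therefore gives the third equations.\<close>
    using that total x y add[OF x y] add[of "e_of U \<otimes> x" y] add[of "e_of U \<otimes> y" x]
    by (metis e_absorb e_closed m_closed)
qed

end

context ordered_supertropical_semiring
begin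

lemma order_trans:
  "leq x y \<Longrightarrow> leq y z \<Longrightarrow> x \<in> carrier U \<Longrightarrow> y \<in> carrier U \<Longrightarrow> z \<in> carrier U \<Longrightarrow> leq x z"
  using total_order by (auto simp: Defs.total_order_on_def dest: transp_onD)

lemma order_antisym:
  "leq x y \<Longrightarrow> leq y x \<Longrightarrow> x \<in> carrier U \<Longrightarrow> y \<in> carrier U \<Longrightarrow> x = y"
  using total_order by (auto simp: Defs.total_order_on_def dest: antisymp_onD)

text \<open>Multiplying 0 \<le> 1 by y gives 0 \<le> y, and adding x to both sides gives the
  claim.\<close>

lemma le_add:
  assumes "x \<in> carrier U" "y \<in> carrier U"
  shows "leq x (x \<oplus> y)"
proof -
  have "leq \<zero> y"
    using mult_mono[OF _ _ assms(2) zero_le_one] assms by simp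
  then show ?thesis
    using add_mono[of \<zero> y x] assms by (simp add: a_comm)
qed

lemma le_e_mult: "x \<in> carrier U \<Longrightarrow> leq x (e_of U \<otimes> x)"
  using le_add[of x x] by (simp add: add_self)

text \<open>The hypotheses are inequalities in U, hence of a kind that a monotone map transports.
  The first one rules out \<open>ey < ex\<close>; if \<open>ex = ey\<close>, the second one forces y
  to be ghost, so that \<open>ex = y\<close>.\<close>

lemma add_eq_right:
  assumes x: "x \<in> carrier U" and y: "y \<in> carrier U"
    and le: "leq (e_of U \<otimes> x) (e_of U \<otimes> y)" "leq (e_of U \<otimes> x) y"
  shows "x \<oplus> y = y"
  using x y
proof (cases rule: add_cases)
  case eq
  then show ?thesis
    using le_e_mult[OF y] le order_antisym y by simp
next
  \<comment> \<open>Here \<open>ey \<le> x \<le> ex\<close>, so together with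
    \<open>ex \<le> ey\<close> the ghosts would coincide, against the case assumption.\<close>
  case greater
  have "leq (e_of U \<otimes> y) x"
    using le_add[of "e_of U \<otimes> y" x] greater x y by simp
  then have "leq (e_of U \<otimes> y) (e_of U \<otimes> x)"
    using le_e_mult[OF x] order_trans x y by simp
  then show ?thesis
    using le greater order_antisym x y by simp
qed

end

lemma monotone_hom_add:
  assumes U: "ordered_supertropical_semiring U leU"
    and V: "ordered_supertropical_semiring V leV"
    and hom: "\<alpha> \<in> hom U V"
    and mono: "monotone_on (carrier U) leU leV \<alpha>"
    and e: "\<alpha> (e_of U) = e_of V"
    and x: "x \<in> carrier U" and y: "y \<in> carrier U"
  shows "\<alpha> (x \<oplus>\<^bsub>U\<^esub> y) = \<alpha> x \<oplus>\<^bsub>V\<^esub> \<alpha> y"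
proof -
  interpret U: ordered_supertropical_semiring U leU by (fact U)
  interpret V: ordered_supertropical_semiring V leV by (fact V)
  have \<alpha>_closed: "\<alpha> z \<in> carrier V" if "z \<in> carrier U" for z
    using hom that by (rule hom_in_carrier)
  have \<alpha>_e: "\<alpha> (e_of U \<otimes>\<^bsub>U\<^esub> z) = e_of V \<otimes>\<^bsub>V\<^esub> \<alpha> z" if "z \<in> carrier U" for z
    using hom_mult[OF hom U.e_closed that] e by simp
  \<comment> \<open>The assumption on a and b yields \<open>ea \<le> b \<le> eb\<close>, and
    \<alpha> carries this chain to V. Strictness may be lost there, but
    \<open>V.add_eq_right\<close> needs only weak inequalities. The fact serves the case
    \<open>less\<close> directly and \<open>greater\<close> with the summands exchanged.\<close>
  have absorb: "\<alpha> a \<oplus>\<^bsub>V\<^esub> \<alpha> b = \<alpha> b"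
    if a: "a \<in> carrier U" and b: "b \<in> carrier U" and ab: "e_of U \<otimes>\<^bsub>U\<^esub> a \<oplus>\<^bsub>U\<^esub> b = b" for a b
  proof (rule V.add_eq_right)
    have le: "leU (e_of U \<otimes>\<^bsub>U\<^esub> a) b"
      using U.le_add[of "e_of U \<otimes>\<^bsub>U\<^esub> a" b] a b ab by simp
    then have "leU (e_of U \<otimes>\<^bsub>U\<^esub> a) (e_of U \<otimes>\<^bsub>U\<^esub> b)"
      using U.le_e_mult[OF b] U.order_trans a b by simp
    with le show "leV (e_of V \<otimes>\<^bsub>V\<^esub> \<alpha> a) (\<alpha> b)"
      and "leV (e_of V \<otimes>\<^bsub>V\<^esub> \<alpha> a) (e_of V \<otimes>\<^bsub>V\<^esub> \<alpha> b)"
      using monotone_onD[OF mono, of "e_of U \<otimes>\<^bsub>U\<^esub> a"] a b by (auto simp flip: \<alpha>_e)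
  qed (use a b \<alpha>_closed in auto)
  from x y show ?thesis
  proof (cases rule: U.add_cases)
    case eq
    then have "e_of V \<otimes>\<^bsub>V\<^esub> \<alpha> x = e_of V \<otimes>\<^bsub>V\<^esub> \<alpha> y"
      using \<alpha>_e x y by metis
    \<comment> \<open>Equality of the two ghosts in V leaves only the first case of
      \<open>V.add_cases\<close>.\<close>
    then have "\<alpha> x \<oplus>\<^bsub>V\<^esub> \<alpha> y = e_of V \<otimes>\<^bsub>V\<^esub> \<alpha> x"
      using V.add_cases[of "\<alpha> x" "\<alpha> y"] x y \<alpha>_closed by metis
    then show ?thesis
      using eq(2) \<alpha>_e[OF x] by simp
  next
    case less
    then show ?thesis
      using absorb x y by simp
  next
    case greater
    then show ?thesis
      using absorb[of y x] x y \<alpha>_closed by (simp add: V.a_comm)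
  qed
qed

text \<open>The ghost semirings have unit e instead of 1, so the point is that \<alpha> maps e = 1 +
  1 to e. Then \<alpha> also maps multiples of e to multiples of e, and the operations are
  inherited.\<close>

lemma semiring_hom_ghost:
  assumes "supertropical_semiring U" and \<alpha>: "\<alpha> \<in> semiring_hom U V"
  shows "\<alpha> \<in> semiring_hom (ghost U) (ghost V)"
proof -
  interpret U: supertropical_semiring U by fact
  have hom: "\<alpha> \<in> ring_hom U V" and zero: "\<alpha> \<zero>\<^bsub>U\<^esub> = \<zero>\<^bsub>V\<^esub>"
    using \<alpha> by (auto simp: semiring_hom_def)
  have e: "\<alpha> (e_of U) = e_of V"
    using ring_hom_add[OF hom U.one_closed U.one_closed] ring_hom_one[OF hom]
    by (simp add: e_of_def)
  have "\<alpha> \<in> ring_hom (ghost U) (ghost V)"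
  proof (rule ring_hom_memI)
    fix z assume "z \<in> carrier (ghost U)"
    then show "\<alpha> z \<in> carrier (ghost V)"
      using ring_hom_mult[OF hom U.e_closed] ring_hom_closed[OF hom] e
      by (auto simp: ghost_def)
  qed (use ring_hom_mult[OF hom] ring_hom_add[OF hom] e in \<open>auto simp: ghost_def\<close>)
  then show ?thesis
    using zero by (simp add: semiring_hom_def ghost_def)
qed

theorem theorem5p3:
  fixes U :: "('a, 'm) ring_scheme" and V :: "('b, 'n) ring_scheme"
    and leU :: "'a \<Rightarrow> 'a \<Rightarrow> bool" and leV :: "'b \<Rightarrow> 'b \<Rightarrow> bool"
    and \<alpha> :: "'a \<Rightarrow> 'b"
  assumes "ordered_supertropical_semiring U leU"
    and "ordered_supertropical_semiring V leV"
    and "\<alpha> \<in> hom U V"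
    and "monotone_on (carrier U) leU leV \<alpha>"
  shows "(\<alpha> \<zero>\<^bsub>U\<^esub> = \<zero>\<^bsub>V\<^esub> \<and> \<alpha> \<one>\<^bsub>U\<^esub> = \<one>\<^bsub>V\<^esub> \<and> \<alpha> (e_of U) = e_of V
            \<longleftrightarrow> \<alpha> \<in> semiring_hom U V)
       \<and> (\<alpha> \<in> semiring_hom U V \<longleftrightarrow> \<alpha> \<in> monotone_transmission U leU V leV)"
proof -
  interpret U: ordered_supertropical_semiring U leU by (fact assms(1))
  have hom_if: "\<alpha> \<in> semiring_hom U V"
    if "\<alpha> \<zero>\<^bsub>U\<^esub> = \<zero>\<^bsub>V\<^esub>" "\<alpha> \<one>\<^bsub>U\<^esub> = \<one>\<^bsub>V\<^esub>" "\<alpha> (e_of U) = e_of V"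
    using that monotone_hom_add[OF assms that(3)] hom_mult[OF assms(3)] hom_in_carrier[OF assms(3)]
    by (auto simp: semiring_hom_def intro!: ring_hom_memI)
  have units: "\<alpha> \<zero>\<^bsub>U\<^esub> = \<zero>\<^bsub>V\<^esub> \<and> \<alpha> \<one>\<^bsub>U\<^esub> = \<one>\<^bsub>V\<^esub> \<and> \<alpha> (e_of U) = e_of V"
    if "\<alpha> \<in> semiring_hom U V"
    using that ring_hom_add[of \<alpha> U V, OF _ U.one_closed U.one_closed]
    by (auto simp: semiring_hom_def e_of_def ring_hom_one)
  have "\<alpha> \<in> semiring_hom U V \<Longrightarrow> \<alpha> \<in> monotone_transmission U leU V leV"
    using units semiring_hom_ghost[OF U.supertropical_semiring_axioms] assms(3,4)
    by (auto simp: monotone_transmission_def transmission_def)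
  \<comment> \<open>(3) leads back to (2) through (1), which is part of being a
    transmission.\<close>
  moreover have "\<alpha> \<in> monotone_transmission U leU V leV \<Longrightarrow> \<alpha> \<in> semiring_hom U V"
    using hom_if by (auto simp: monotone_transmission_def transmission_def)
  ultimately show ?thesis
    using hom_if units by blast
qed

end
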